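(* Let $F$ be a field of characteristic $2$, and let $U=\begin{pmatrix} A\\ B\end{pmatrix}$ be an orthogonal $2n\times 2n$ matrix over $F$ (i.e. $UU^{T}=I_{2n}$), where $A$ and $B$ are blocks of size $n\times 2n$. Then the convolutional code with generator matrix $G[z]=A+Bz$ is a self-dual code.
   Context: The convolutional code with generator matrix $G[z]\in F[z]^{n\times 2n}$ is the $F[z]$-submodule $\{u(z)G[z]:u(z)\in F[z]^n\}$ of $F[z]^{2n}$. A convolutional $(2n,n)$ code with generator matrix $G[z]$ is called self-dual if $G[z]\,G[z^{-1}]^{T}=0$ (the transpose of $z$ being interpreted as $z^{-1}$). *)

theory Defs
  imports
    "Jordan_Normal_Form.Matrix"
    "HOL-Computational_Algebra.Formal_Laurent_Series"
begin

text \<open>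
  For a row vector \<open>u(z)\<close>, the vector \<open>u(z) G[z]\<close> is written \<open>G\<^sup>T u\<close>, since vectors of the
  matrix library are not distinguished into rows and columns.
\<close>

definition conv_code :: "'a::field poly mat \<Rightarrow> 'a poly vec set" where
  "conv_code G = {transpose_mat G *\<^sub>v u | u. u \<in> carrier_vec (dim_row G)}"

text \<open>
  \<open>C\<close> is a convolutional \<open>(m, k)\<close> code with generator matrix \<open>G\<close>: length \<open>m\<close> and dimension \<open>k\<close>,
  the latter meaning that the \<open>k\<close> rows of \<open>G\<close> are linearly independent over \<open>F[z]\<close>.
\<close>

definition conv_code_with_generator ::
  "nat \<Rightarrow> nat \<Rightarrow> 'a::field poly mat \<Rightarrow> 'a poly vec set \<Rightarrow> bool" where
  "conv_code_with_generator m k G C \<longleftrightarrow>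
     G \<in> carrier_mat k m \<and>
     C = conv_code G \<and>
     (\<forall>u \<in> carrier_vec k. transpose_mat G *\<^sub>v u = 0\<^sub>v m \<longrightarrow> u = 0\<^sub>v k)"

text \<open>
  Entrywise substitution of \<open>x\<close> for \<open>z\<close>. Since \<open>z\<^sup>-\<^sup>1\<close> is not a polynomial, the values live in
  the formal Laurent series \<open>F((z))\<close>, which contain \<open>F[z, z\<^sup>-\<^sup>1]\<close>; \<open>x = fls_X\<close> is the embedding
  of \<open>F[z]\<close>, and \<open>x = fls_X_inv\<close> is the substitution of \<open>z\<^sup>-\<^sup>1\<close>.
\<close>

definition subst_mat :: "'a::field poly mat \<Rightarrow> 'a fls \<Rightarrow> 'a fls mat" where
  "subst_mat G x = map_mat (\<lambda>p. poly (map_poly fls_const p) x) G"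

definition self_dual_conv_code ::
  "nat \<Rightarrow> 'a::field poly mat \<Rightarrow> 'a poly vec set \<Rightarrow> bool" where
  "self_dual_conv_code n G C \<longleftrightarrow>
     conv_code_with_generator (2 * n) n G C \<and>
     subst_mat G fls_X * transpose_mat (subst_mat G fls_X_inv) = 0\<^sub>m n n"

definition const_poly_mat :: "'a::field mat \<Rightarrow> 'a poly mat" where
  "const_poly_mat A = map_mat (\<lambda>a. [:a:]) A"

end

theory Submission
  imports Defs
begin

text \<open>
  The blocks of \<open>U U\<^sup>T = I\<close> say \<open>A A\<^sup>T = B B\<^sup>T = I\<close> and \<open>A B\<^sup>T = B A\<^sup>T = 0\<close>. Hence
  \<open>(A + B x) (A + B y)\<^sup>T = (1 + x y) I\<close>, which is \<open>2 I = 0\<close> for \<open>x = z\<close>, \<open>y = z\<^sup>-\<^sup>1\<close>. The rows of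
  \<open>G[z]\<close> are independent because \<open>A\<^sup>T\<close> is a right inverse: \<open>(A + B z) A\<^sup>T = I\<close>.
\<close>

text \<open>\<open>@\<^sub>r\<close> is a four-block matrix whose right-hand blocks have width 0.
  Transposing turns these into blocks of height 0, and in the block product they contribute only
  products over an empty index range, which are zero.\<close>

lemma append_rows_mult_transpose:
  fixes A B C D :: "'a::comm_semiring_0 mat"
  assumes "A \<in> carrier_mat k n" "B \<in> carrier_mat l n"
    and "C \<in> carrier_mat p n" "D \<in> carrier_mat q n"
  shows "(A @\<^sub>r B) * (C @\<^sub>r D)\<^sup>T = four_block_mat (A * C\<^sup>T) (A * D\<^sup>T) (B * C\<^sup>T) (B * D\<^sup>T)"
proof -
  have T: "(C @\<^sub>r D)\<^sup>T = four_block_mat C\<^sup>T D\<^sup>T (0\<^sub>m 0 p) (0\<^sub>m 0 q)"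
    unfolding append_rows_def
    using assms transpose_four_block_mat[of C p n "0\<^sub>m p 0" 0 D q "0\<^sub>m q 0"] by simp
  have "(A @\<^sub>r B) * (C @\<^sub>r D)\<^sup>T =
      four_block_mat (A * C\<^sup>T + 0\<^sub>m k 0 * 0\<^sub>m 0 p) (A * D\<^sup>T + 0\<^sub>m k 0 * 0\<^sub>m 0 q)
        (B * C\<^sup>T + 0\<^sub>m l 0 * 0\<^sub>m 0 p) (B * D\<^sup>T + 0\<^sub>m l 0 * 0\<^sub>m 0 q)"
    unfolding T unfolding append_rows_def
    using assms
    by (subst mult_four_block_mat[of A k n _ 0 B l _ _ p _ q]) auto
  then show ?thesis
    using assms by simp
qed

lemma four_block_mat_eq_oneD:
  assumes "four_block_mat A B C D = 1\<^sub>m (k + l)"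
    and "A \<in> carrier_mat k k" "B \<in> carrier_mat k l" "C \<in> carrier_mat l k" "D \<in> carrier_mat l l"
  shows "A = 1\<^sub>m k" "B = 0\<^sub>m k l" "C = 0\<^sub>m l k" "D = 1\<^sub>m l"
proof -
  \<comment> \<open>Each block is read off from \<open>E\<close> with the row index shifted by
    \<open>k\<close> for the lower blocks and the column index shifted by \<open>k\<close> for the
    right ones. In the mixed blocks exactly one index is shifted, so the diagonal is never
    met.\<close>
  have E: "four_block_mat A B C D $$ (i, j) = (if i = j then 1 else 0)"
    if "i < k + l" "j < k + l" for i j
    using that by (simp add: assms(1))
  show "A = 1\<^sub>m k"
  proof (rule eq_matI)
    fix i j assume "i < dim_row (1\<^sub>m k)" "j < dim_col (1\<^sub>m k)"
    then show "A $$ (i, j) = 1\<^sub>m k $$ (i, j)" using E[of i j] assms(2-) by simp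
  qed (use assms in auto)
  show "B = 0\<^sub>m k l"
  proof (rule eq_matI)
    fix i j assume "i < dim_row (0\<^sub>m k l)" "j < dim_col (0\<^sub>m k l)"
    then show "B $$ (i, j) = 0\<^sub>m k l $$ (i, j)" using E[of i "k + j"] assms(2-) by simp
  qed (use assms in auto)
  show "C = 0\<^sub>m l k"
  proof (rule eq_matI)
    fix i j assume "i < dim_row (0\<^sub>m l k)" "j < dim_col (0\<^sub>m l k)"
    then show "C $$ (i, j) = 0\<^sub>m l k $$ (i, j)" using E[of "k + i" j] assms(2-) by simp
  qed (use assms in auto)
  show "D = 1\<^sub>m l"
  proof (rule eq_matI)
    fix i j assume "i < dim_row (1\<^sub>m l)" "j < dim_col (1\<^sub>m l)"
    then show "D $$ (i, j) = 1\<^sub>m l $$ (i, j)" using E[of "k + i" "k + j"] assms(2-) by simp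
  qed (use assms in auto)
qed

lemma orthogonal_append_rowsD:
  fixes A B :: "'a::comm_semiring_1 mat"
  assumes "A \<in> carrier_mat k n" "B \<in> carrier_mat l n"
    and "(A @\<^sub>r B) * (A @\<^sub>r B)\<^sup>T = 1\<^sub>m (k + l)"
  shows "A * A\<^sup>T = 1\<^sub>m k" "A * B\<^sup>T = 0\<^sub>m k l" "B * A\<^sup>T = 0\<^sub>m l k" "B * B\<^sup>T = 1\<^sub>m l"
proof -
  have "four_block_mat (A * A\<^sup>T) (A * B\<^sup>T) (B * A\<^sup>T) (B * B\<^sup>T) = 1\<^sub>m (k + l)"
    using assms append_rows_mult_transpose[of A k n B l A k B l] by simp
  from four_block_mat_eq_oneD[OF this]
  show "A * A\<^sup>T = 1\<^sub>m k" "A * B\<^sup>T = 0\<^sub>m k l" "B * A\<^sup>T = 0\<^sub>m l k" "B * B\<^sup>T = 1\<^sub>m l"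
    using assms by simp_all
qed

text \<open>Bilinearity of the scalar product of rows. The two scalars are independent so that z and
  its inverse can be put in separately.\<close>

lemma pencil_mult_transpose:
  fixes P Q R S :: "'a::comm_ring_1 mat"
  assumes "P \<in> carrier_mat k n" "Q \<in> carrier_mat k n"
    and "R \<in> carrier_mat l n" "S \<in> carrier_mat l n"
  shows "(P + x \<cdot>\<^sub>m Q) * (R + y \<cdot>\<^sub>m S)\<^sup>T =
    P * R\<^sup>T + y \<cdot>\<^sub>m (P * S\<^sup>T) + x \<cdot>\<^sub>m (Q * R\<^sup>T) + (x * y) \<cdot>\<^sub>m (Q * S\<^sup>T)"
  using assms
  by (intro eq_matI)
    (auto simp: add_scalar_prod_distrib[of _ n] scalar_prod_add_distrib[of _ n]
      row_add algebra_simps)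

text \<open>This embedding and the next one carry the block relations from F to Laurent series, for
  self-duality, and to polynomials, for independence of the rows.\<close>

lemma semiring_hom_fls_const: "semiring_hom (fls_const :: 'a::comm_semiring_1 \<Rightarrow> 'a fls)"
  by unfold_locales (simp_all add: fls_plus_const fls_const_mult_const)

lemma semiring_hom_const_poly: "semiring_hom (\<lambda>a. [:a::'a::comm_semiring_1:])"
  by unfold_locales (simp_all add: mult.commute)

lemma (in semiring_hom) mat_hom_mult_transpose:
  assumes "A \<in> carrier_mat k n" "B \<in> carrier_mat l n"
  shows "map_mat hom A * (map_mat hom B)\<^sup>T = map_mat hom (A * B\<^sup>T)"
  using assms by (simp add: mat_hom_mult[of A k n "B\<^sup>T" l] map_mat_transpose)

lemma (in semiring_hom) mat_hom_zero: "map_mat hom (0\<^sub>m k l) = 0\<^sub>m k l"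
  by (rule eq_matI) auto

text \<open>Every entry is a polynomial a + bz, whose value at \<open>x\<close> is a + xb. As
  \<open>x\<close> is arbitrary, this serves both substitutions in the definition of
  self-duality.\<close>

lemma subst_mat_pencil:
  fixes A B :: "'a::field mat"
  assumes "A \<in> carrier_mat k n" "B \<in> carrier_mat k n"
  shows "subst_mat (const_poly_mat A + [:0, 1:] \<cdot>\<^sub>m const_poly_mat B) x =
    map_mat fls_const A + x \<cdot>\<^sub>m map_mat fls_const B"
  using assms
  by (intro eq_matI) (auto simp: subst_mat_def const_poly_mat_def map_poly_pCons mult.commute)

text \<open>Transposing the hypothesis on \<open>G * R\<^sup>T\<close> makes \<open>R\<close> a left
  inverse of \<open>G\<^sup>T\<close>, which is therefore injective. This gives independence of the
  rows over a ring, without division.\<close>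

lemma transpose_mult_vec_eq_zeroD:
  fixes G R :: "'a::comm_ring_1 mat"
  assumes "G \<in> carrier_mat k n" "R \<in> carrier_mat k n" "G * R\<^sup>T = 1\<^sub>m k"
    and "u \<in> carrier_vec k" "G\<^sup>T *\<^sub>v u = 0\<^sub>v n"
  shows "u = 0\<^sub>v k"
proof -
  have "R * G\<^sup>T = (G * R\<^sup>T)\<^sup>T"
    using assms by (subst transpose_mult) auto
  then have "u = (R * G\<^sup>T) *\<^sub>v u"
    using assms by simp
  also have "\<dots> = R *\<^sub>v (G\<^sup>T *\<^sub>v u)"
    using assms by (intro assoc_mult_mat_vec) auto
  also have "\<dots> = 0\<^sub>v k"
    using assms by (auto intro!: eq_vecI)
  finally show ?thesis .
qed

theorem lemma8p1:
  fixes U A B :: "'a::field mat" and G :: "'a poly mat" and n :: nat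
  assumes "CHAR('a) = 2"
    and "A \<in> carrier_mat n (2 * n)"
    and "B \<in> carrier_mat n (2 * n)"
    and "U = A @\<^sub>r B"
    and "U * transpose_mat U = 1\<^sub>m (2 * n)"
    and "G = const_poly_mat A + [:0, 1:] \<cdot>\<^sub>m const_poly_mat B"
  shows "self_dual_conv_code n G (conv_code G)"
proof -
  note A = assms(2) and B = assms(3) and G = assms(6)
  \<comment> \<open>Writing the size as \<open>n + n\<close> marks where the identity matrix is cut
    into blocks.\<close>
  have "(A @\<^sub>r B) * (A @\<^sub>r B)\<^sup>T = 1\<^sub>m (n + n)"
    using assms(4,5) by (simp add: mult_2)
  note orth = orthogonal_append_rowsD[OF A B this]
  have X: "fls_X * fls_X_inv = (1 :: 'a fls)"
    by (simp flip: fls_inverse_X)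
  interpret c: semiring_hom "\<lambda>a::'a. [:a:]" by (rule semiring_hom_const_poly)
  interpret f: semiring_hom "fls_const :: 'a \<Rightarrow> 'a fls" by (rule semiring_hom_fls_const)
  let ?Ap = "const_poly_mat A" and ?Bp = "const_poly_mat B"
  let ?Af = "map_mat fls_const A" and ?Bf = "map_mat fls_const B"
  have p: "?Ap \<in> carrier_mat n (2 * n)" "?Bp \<in> carrier_mat n (2 * n)"
    using A B by (auto simp: const_poly_mat_def)
  have Gc: "G \<in> carrier_mat n (2 * n)"
    using p unfolding G by simp
  have "G * ?Ap\<^sup>T = ?Ap * ?Ap\<^sup>T + [:0, 1:] \<cdot>\<^sub>m (?Bp * ?Ap\<^sup>T)"
    unfolding G using p
    by (simp add: add_mult_distrib_mat[of _ n "2 * n" _ _ n] mult_smult_assoc_mat[of _ n "2 * n" _ n])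
  \<comment> \<open>The coefficient of z is the image of \<open>B * A\<^sup>T = 0\<close>, and the
    constant term that of \<open>A * A\<^sup>T = 1\<^sub>m n\<close>.\<close>
  also have "\<dots> = 1\<^sub>m n"
    by (simp add: const_poly_mat_def c.mat_hom_mult_transpose[OF A A]
        c.mat_hom_mult_transpose[OF B A] orth c.mat_hom_one c.mat_hom_zero)
  finally have inv: "G * ?Ap\<^sup>T = 1\<^sub>m n" .
  have "subst_mat G fls_X * (subst_mat G fls_X_inv)\<^sup>T =
      ?Af * ?Af\<^sup>T + fls_X_inv \<cdot>\<^sub>m (?Af * ?Bf\<^sup>T) + fls_X \<cdot>\<^sub>m (?Bf * ?Af\<^sup>T)
        + (fls_X * fls_X_inv) \<cdot>\<^sub>m (?Bf * ?Bf\<^sup>T)"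
    unfolding G subst_mat_pencil[OF A B] using A B by (intro pencil_mult_transpose) auto
  \<comment> \<open>The mixed products vanish, and \<open>X\<close> reduces the scalar of the last
    term to 1.\<close>
  also have "\<dots> = 1\<^sub>m n + 1 \<cdot>\<^sub>m 1\<^sub>m n"
    by (simp add: f.mat_hom_mult_transpose[OF A A] f.mat_hom_mult_transpose[OF A B]
        f.mat_hom_mult_transpose[OF B A] f.mat_hom_mult_transpose[OF B B]
        orth f.mat_hom_one f.mat_hom_zero X)
  also have "\<dots> = 0\<^sub>m n n"
  proof -
    \<comment> \<open>Characteristic 2 enters here: the two identity matrices cancel once 1 + 1 = 0
      is carried from F to the Laurent series by \<open>fls_const\<close>.\<close>
    have "(1::'a) + 1 = 0"
      using of_nat_CHAR[where 'a = 'a] assms(1) by simp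
    then have "(1::'a fls) + 1 = 0"
      by (metis f.hom_add f.hom_one f.hom_zero)
    then show ?thesis
      by (intro eq_matI) auto
  qed
  finally show ?thesis
    using Gc transpose_mult_vec_eq_zeroD[OF Gc p(1) inv]
    by (auto simp: self_dual_conv_code_def conv_code_with_generator_def)
qed

end
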